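(* Consider the evidence-augmented LMSR, let $\beta(R)$ be positive and decreasing in $R$, and suppose trader $t$ submits evidence set $E'_t\subseteq E_t$ (and reports the corresponding true belief $q_t(E'_t)$). Then $$x=\beta\big(r(E^{total}_{t-1})\big)-\beta\big(r(E^{total}_{t-1}\cup E'_t)\big)$$ is nonnegative, and the expected payoff of trader $t$, taken with respect to $q_t(E'_t)$, decomposes as $$\mathrm{payoff}_t(E'_t)=\beta(R_{t-1})\,D_{\mathrm{KL}}\big(q_t(E'_t)\,\|\,q_{t-1}\big)+x\,H\big(q_t(E'_t)\big).$$ Moreover: (a) Under exogenous resolution (where $q_t(E'_t)=q_t$ for all $E'_t$), it is strictly optimal for the trader to submit the complete evidence set $E_t$ and the true belief $q_t$, i.e. this choice gives strictly larger expected payoff (under $q_t$) than any other choice of $E'_t\subseteq E_t$ and report $\hat q_t$. (b) Under endogenous resolution, for any $\varepsilon>0$ there exists a temperature $\tau$ such that, when the market resolves with softmax temperature $\tau$, the trader cannot increase their payoff by more than $\varepsilon$ by submitting a partial set: $\mathrm{payoff}_t(E'_t)-\mathrm{payoff}_t(E_t)\le\varepsilon$ for every $E'_t\subseteq E_t$.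
   Context: There are $n$ alternatives. Traders arrive sequentially. Trader $t$ holds a finite evidence set $E_t$ and submits $E'_t\subseteq E_t$ and a report $\hat q_t$. Evidence quality is a function $r$ on finite evidence sets with $r(E)\ge0$ and monotone increasing: $r(E_1)\le r(E_2)$ whenever $E_1\subseteq E_2$. $E^{total}_{t-1}$ is the evidence in the market before trader $t$, and $R_{t-1}=r(E^{total}_{t-1})$, $R_t=r(E^{total}_{t-1}\cup E'_t)$. The liquidity function is $\beta:[0,\infty)\to(0,\infty)$. Beliefs and reports are in the relative interior of the $(n-1)$-simplex; $q^\omega$ is the probability $q$ assigns to $\omega$; $q_{t-1}$ is the report of the preceding trader (the uniform distribution for the first trader). $H(q)=-\sum_\omega q^\omega\log q^\omega$ is Shannon entropy and $D_{\mathrm{KL}}(p\|q)=\sum_\omega p^\omega\log(p^\omega/q^\omega)$. Evidence-augmented LMSR: when the resolution outcome is $\omega$, $\mathrm{payoff}_t(\hat q_t,E'_t)=\beta(R_t)\log\hat q_t^{\,\omega}-\beta(R_{t-1})\log q_{t-1}^{\,\omega}$. The trader's true belief about resolution given submission $E'_t$ is $q_t(E'_t)$, and $\mathrm{payoff}_t(E'_t)$ denotes the expectation of $\mathrm{payoff}_t(q_t(E'_t),E'_t)$ over $\omega\sim q_t(E'_t)$. Under exogenous resolution $q_t(E'_t)=q_t$ is a fixed belief not depending on $E'_t$. Endogenous resolution: each atomic piece of evidence $e$ has outcomes $X_{ie}\in\{0,1\}$, $i=1,\dots,n$ ($1$ if $e$ supports alternative $i$). Once exactly $K$ pieces have accumulated,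 let $\theta_i=\frac1K\sum_eX_{ie}$; the market resolves to $j$ with probability $\exp(\theta_j/\tau)/\sum_\ell\exp(\theta_\ell/\tau)$, where $\tau>0$ is the temperature. When trader $t$ arrives there are $k(t)$ pieces, $k_j(t)$ of which support $j$, and $k(t)+|E_t|\le K$. If $E'_t$ is submitted, with $|E'_{t,j}|$ of its pieces supporting $j$, then $K-k(t)-|E'_t|$ further pieces arrive; the trader has a probability distribution, not depending on what they submit, over the sequence of outcome vectors of future pieces, and $S_j$ is the number of pieces supporting $j$ among the first $K-k(t)-|E'_t|$ of them. With $\theta_{tj}(E'_t)=\frac{k_j(t)+|E'_{t,j}|+S_j}{K}$, the belief is $q_{tj}(E'_t)=\mathbb{E}\big[\exp(\theta_{tj}(E'_t)/\tau)/\sum_\ell\exp(\theta_{t\ell}(E'_t)/\tau)\big]$, expectation over future evidence. Earlier traders report their true beliefs, so in the endogenous case $q_{t-1}$ is itself a mixture of vectors $\mathrm{softmax}(\theta;\tau)$ with $\theta\in[0,1]^n$, at the same temperature $\tau$.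
   Formalization: In (a), strictness is claimed for n ≥ 2, β strictly decreasing, and choices differing in report or achieved quality r (all other choices if withholding any evidence lowers r); otherwise only weak optimality is claimed, as ties occur for constant r or n = 1. *)

theory Defs
  imports "HOL-Probability.Probability"
begin

text \<open>The \<open>n\<close> alternatives are the elements of a finite type \<open>'n\<close>; beliefs and reports are
  vectors in \<open>real ^ 'n\<close>.\<close>

definition prob_simplex :: "(real ^ 'n) set" where
  "prob_simplex = {q. (\<forall>i. 0 \<le> q $ i) \<and> (\<Sum>i\<in>UNIV. q $ i) = 1}"

abbreviation open_simplex :: "(real ^ 'n) set" where
  "open_simplex \<equiv> rel_interior prob_simplex"

lemma open_simplex_eq:
  "(open_simplex :: (real ^ 'n) set) = {q. (\<forall>i. 0 < q $ i) \<and> (\<Sum>i\<in>UNIV. q $ i) = 1}"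
proof -
  let ?O = "{q :: real ^ 'n. \<forall>i. 0 \<le> q $ i}"
  let ?A = "{q :: real ^ 'n. (\<Sum>i\<in>UNIV. q $ i) = 1}"
  have eq: "prob_simplex = ?O \<inter> ?A"
    by (auto simp: prob_simplex_def)
  have cvx: "convex ?O"
    by (auto simp: convex_def)
  have aff: "affine ?A"
    by (auto simp: affine_def sum.distrib sum_distrib_left[symmetric])
  have int: "interior ?O = {q. \<forall>i. 0 < q $ i}"
  proof
    show "interior ?O \<subseteq> {q. \<forall>i. 0 < q $ i}"
    proof clarify
      fix q i assume "q \<in> interior ?O"
      moreover have "interior ?O \<subseteq> interior {x. x $ i \<ge> 0}"
        by (rule interior_mono) auto
      ultimately show "0 < q $ i"
        by (auto simp: interior_halfspace_component_ge)
    qed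
    have "{q :: real ^ 'n. \<forall>i. 0 < q $ i} = (\<Inter>i. {q. q $ i > 0})"
      by auto
    moreover have "open (\<Inter>i. {q :: real ^ 'n. q $ i > 0})"
      by (intro open_INT finite open_halfspace_component_gt_cart ballI)
    ultimately show "{q. \<forall>i. 0 < q $ i} \<subseteq> interior ?O"
      by (intro interior_maximal) (auto simp: less_imp_le)
  qed
  have "(\<chi> i. 1 / real CARD('n)) \<in> interior ?O \<inter> ?A"
    by (simp add: int)
  then have "rel_interior (?O \<inter> ?A) = interior ?O \<inter> ?A"
    using cvx aff by (intro rel_interior_convex_Int_affine) blast+
  then show ?thesis
    by (auto simp: eq int)
qed

definition shannon_entropy :: "real ^ 'n \<Rightarrow> real" where
  "shannon_entropy q = - (\<Sum>\<omega>\<in>UNIV. q $ \<omega> * ln (q $ \<omega>))"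

definition KL_div :: "real ^ 'n \<Rightarrow> real ^ 'n \<Rightarrow> real" where
  "KL_div p q = (\<Sum>\<omega>\<in>UNIV. p $ \<omega> * ln (p $ \<omega> / q $ \<omega>))"

text \<open>In the following, \<open>A\<close> is the evidence in the market before the trader, \<open>q0\<close> the preceding
  report, \<open>p\<close> the trader's report and \<open>E'\<close> the submitted evidence.\<close>

definition payoff ::
  "(real \<Rightarrow> real) \<Rightarrow> ('e set \<Rightarrow> real) \<Rightarrow> 'e set \<Rightarrow> real ^ 'n \<Rightarrow> real ^ 'n \<Rightarrow> 'e set \<Rightarrow> 'n \<Rightarrow> real"
  where
  "payoff \<beta> r A q0 p E' \<omega> = \<beta> (r (A \<union> E')) * ln (p $ \<omega>) - \<beta> (r A) * ln (q0 $ \<omega>)"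

definition expected_payoff ::
  "(real \<Rightarrow> real) \<Rightarrow> ('e set \<Rightarrow> real) \<Rightarrow> 'e set \<Rightarrow> real ^ 'n \<Rightarrow> real ^ 'n \<Rightarrow> real ^ 'n \<Rightarrow> 'e set \<Rightarrow> real"
  where
  "expected_payoff \<beta> r A q0 b p E' = (\<Sum>\<omega>\<in>UNIV. b $ \<omega> * payoff \<beta> r A q0 p E' \<omega>)"
  \<comment> \<open>\<open>b\<close> is the distribution of the outcome, \<open>p\<close> the report\<close>

definition softmax :: "real \<Rightarrow> real ^ 'n \<Rightarrow> real ^ 'n" where
  "softmax \<tau> \<theta> = (\<chi> j. exp (\<theta> $ j / \<tau>) / (\<Sum>l\<in>UNIV. exp (\<theta> $ l / \<tau>)))"

text \<open>Mixtures of softmax vectors of \<open>\<theta> \<in> [0,1]\<^sup>n\<close>; a point mass at a constant \<open>\<theta>\<close> gives the uniform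
  distribution.\<close>

definition softmax_mixture :: "real \<Rightarrow> real ^ 'n \<Rightarrow> bool" where
  "softmax_mixture \<tau> q \<longleftrightarrow>
     (\<exists>M. prob_space M \<and> sets M = sets borel \<and>
          (AE \<theta> in M. \<forall>i. 0 \<le> \<theta> $ i \<and> \<theta> $ i \<le> 1) \<and>
          q = (\<chi> j. integral\<^sup>L M (\<lambda>\<theta>. softmax \<tau> \<theta> $ j)))"

text \<open>\<open>X e j\<close> means that the atomic piece \<open>e\<close> supports alternative \<open>j\<close>. Future pieces are given by
  the list of their outcome vectors, in order of arrival; only the first
  \<open>K - card A - card E'\<close> of them arrive before the market closes.\<close>

definition final_share ::
  "nat \<Rightarrow> ('e \<Rightarrow> 'n \<Rightarrow> bool) \<Rightarrow> 'e set \<Rightarrow> 'e set \<Rightarrow> ('n \<Rightarrow> bool) list \<Rightarrow> real ^ 'n" where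
  "final_share K X A E' xs = (\<chi> j.
     real (card {e \<in> A. X e j} + card {e \<in> E'. X e j} +
           length (filter (\<lambda>v. v j) (take (K - card A - card E') xs))) / real K)"

definition endo_belief ::
  "real \<Rightarrow> nat \<Rightarrow> ('e \<Rightarrow> 'n \<Rightarrow> bool) \<Rightarrow> 'e set \<Rightarrow> ('n \<Rightarrow> bool) list pmf \<Rightarrow> 'e set \<Rightarrow> real ^ 'n" where
  "endo_belief \<tau> K X A fut E' =
     (\<chi> j. measure_pmf.expectation fut (\<lambda>xs. softmax \<tau> (final_share K X A E' xs) $ j))"

end

theory Submission
  imports Defs
begin

text \<open>The expected payoff is \<open>\<beta>(R\<^sub>t)\<close> times the negated cross entropy of belief and report, minus a term
  that depends on the report of the predecessor only. Gibbs' inequality makes the true belief the best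
  report; since entropies are nonnegative, more evidence, i.e. a smaller \<open>\<beta>\<close>, then only helps.
  For endogenous resolution, softmax at temperature \<open>\<tau>\<close> of a vector in \<open>[0,1]\<^sup>n\<close> has all coordinates
  between \<open>exp (-1/\<tau>)/n\<close> and \<open>exp (1/\<tau>)/n\<close>, and so have mixtures of such vectors. Hence for large \<open>\<tau>\<close>
  all beliefs are nearly uniform, and the manipulation of the belief gains at most \<open>4 \<beta>(R\<^sub>t\<^sub>-\<^sub>1)/\<tau>\<close>.\<close>

section \<open>Cross entropies, Gibbs' inequality and Shannon entropy\<close>

lemma expected_payoff_eq:
  "expected_payoff \<beta> r A q0 b p E' =
     \<beta> (r (A \<union> E')) * (\<Sum>\<omega>\<in>UNIV. b $ \<omega> * ln (p $ \<omega>)) - \<beta> (r A) * (\<Sum>\<omega>\<in>UNIV. b $ \<omega> * ln (q0 $ \<omega>))"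
  by (simp add: expected_payoff_def payoff_def algebra_simps sum_subtractf sum_distrib_left)

lemma KL_div_eq_diff:
  fixes p q :: "real ^ 'n"
  assumes "p \<in> open_simplex" "q \<in> open_simplex"
  shows "KL_div p q = (\<Sum>\<omega>\<in>UNIV. p $ \<omega> * ln (p $ \<omega>)) - (\<Sum>\<omega>\<in>UNIV. p $ \<omega> * ln (q $ \<omega>))"
  using assms by (simp add: KL_div_def open_simplex_eq ln_divide_pos algebra_simps sum_subtractf)

text \<open>Apply \<open>ln t \<le> t - 1\<close>, with equality only at \<open>t = 1\<close>, to
  \<open>t = p $ \<omega> / q $ \<omega>\<close>, weight by \<open>q $ \<omega>\<close> and sum: the
  right-hand sides add up to \<open>1 - 1 = 0\<close>. A single coordinate in which \<open>p\<close>
  and \<open>q\<close> differ makes the sum strict.\<close>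

lemma Gibbs_inequality_strict:
  fixes p q :: "real ^ 'n"
  assumes p: "p \<in> open_simplex" and q: "q \<in> open_simplex" and "p \<noteq> q"
  shows "(\<Sum>\<omega>\<in>UNIV. q $ \<omega> * ln (p $ \<omega>)) < (\<Sum>\<omega>\<in>UNIV. q $ \<omega> * ln (q $ \<omega>))"
proof -
  have pos: "0 < p $ \<omega>" "0 < q $ \<omega>" for \<omega>
    using p q by (auto simp: open_simplex_eq)
  have le: "q $ \<omega> * ln (p $ \<omega>) - q $ \<omega> * ln (q $ \<omega>) \<le> p $ \<omega> - q $ \<omega>" (is ?le)
    and lt: "p $ \<omega> \<noteq> q $ \<omega> \<Longrightarrow> q $ \<omega> * ln (p $ \<omega>) - q $ \<omega> * ln (q $ \<omega>) < p $ \<omega> - q $ \<omega>" for \<omega>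
  proof -
    have eq: "q $ \<omega> * ln (p $ \<omega>) - q $ \<omega> * ln (q $ \<omega>) = q $ \<omega> * ln (p $ \<omega> / q $ \<omega>)"
      "p $ \<omega> - q $ \<omega> = q $ \<omega> * (p $ \<omega> / q $ \<omega> - 1)"
      using pos[of \<omega>] by (simp_all add: ln_div algebra_simps)
    have ln_le: "ln (p $ \<omega> / q $ \<omega>) \<le> p $ \<omega> / q $ \<omega> - 1"
      using pos[of \<omega>] by (intro ln_le_minus_one) simp
    then show ?le
      unfolding eq using pos(2)[of \<omega>] by (intro mult_left_mono) auto
    assume "p $ \<omega> \<noteq> q $ \<omega>"
    then have "ln (p $ \<omega> / q $ \<omega>) \<noteq> p $ \<omega> / q $ \<omega> - 1"
      using ln_eq_minus_one[of "p $ \<omega> / q $ \<omega>"] pos[of \<omega>] by auto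
    with ln_le have "ln (p $ \<omega> / q $ \<omega>) < p $ \<omega> / q $ \<omega> - 1"
      by linarith
    then show "q $ \<omega> * ln (p $ \<omega>) - q $ \<omega> * ln (q $ \<omega>) < p $ \<omega> - q $ \<omega>"
      unfolding eq using pos(2)[of \<omega>] by (rule mult_strict_left_mono)
  qed
  obtain \<omega> where "p $ \<omega> \<noteq> q $ \<omega>"
    using \<open>p \<noteq> q\<close> by (auto simp: vec_eq_iff)
  then have "(\<Sum>\<omega>\<in>UNIV. q $ \<omega> * ln (p $ \<omega>) - q $ \<omega> * ln (q $ \<omega>)) < (\<Sum>\<omega>\<in>UNIV. p $ \<omega> - q $ \<omega>)"
    using le lt by (intro sum_strict_mono_ex1) auto
  also have "\<dots> = 0"
    using p q by (simp add: sum_subtractf open_simplex_eq)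
  finally show ?thesis
    by (simp add: sum_subtractf)
qed

lemma Gibbs_inequality:
  fixes p q :: "real ^ 'n"
  assumes "p \<in> open_simplex" "q \<in> open_simplex"
  shows "(\<Sum>\<omega>\<in>UNIV. q $ \<omega> * ln (p $ \<omega>)) \<le> (\<Sum>\<omega>\<in>UNIV. q $ \<omega> * ln (q $ \<omega>))"
  using Gibbs_inequality_strict[OF assms] by (cases "p = q") auto

lemma open_simplex_le_1:
  fixes q :: "real ^ 'n"
  assumes "q \<in> open_simplex"
  shows "q $ i \<le> 1"
  using assms member_le_sum[of i UNIV "\<lambda>i. q $ i"] by (auto simp: open_simplex_eq less_imp_le)

lemma shannon_entropy_nonneg:
  fixes q :: "real ^ 'n"
  assumes "q \<in> open_simplex"
  shows "0 \<le> shannon_entropy q"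
proof -
  have "q $ i * ln (q $ i) \<le> 0" for i
    using assms open_simplex_le_1[OF assms, of i]
    by (intro mult_nonneg_nonpos) (auto simp: open_simplex_eq less_imp_le)
  then show ?thesis
    by (simp add: shannon_entropy_def sum_nonpos)
qed

text \<open>A second alternative has positive mass, which pushes every coordinate strictly below 1,
  so every term \<open>- (q $ i * ln (q $ i))\<close> is positive. With one alternative the entropy
  would be 0 and evidence would earn nothing.\<close>

lemma shannon_entropy_pos:
  fixes q :: "real ^ 'n"
  assumes q: "q \<in> open_simplex" and card: "2 \<le> CARD('n)"
  shows "0 < shannon_entropy q"
proof -
  have "q $ i < 1" for i
  proof -
    have "UNIV - {i} \<noteq> {}"
      using card card_Diff_singleton[of i UNIV] by (metis One_nat_def UNIV_I card.empty diff_is_0_eq not_less_eq_eq numeral_2_eq_2)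
    then have "0 < (\<Sum>j\<in>UNIV - {i}. q $ j)"
      using q by (intro sum_pos) (auto simp: open_simplex_eq)
    then show ?thesis
      using q sum.remove[of UNIV i "\<lambda>j. q $ j"] by (simp add: open_simplex_eq)
  qed
  then have "0 < (\<Sum>i\<in>UNIV. - (q $ i * ln (q $ i)))"
    using q by (intro sum_pos) (auto simp: open_simplex_eq intro!: mult_pos_neg)
  then show ?thesis
    by (simp add: shannon_entropy_def sum_negf)
qed

section \<open>Softmax vectors and their mixtures\<close>

text \<open>Every exponential lies between 1 and \<open>exp (1 / \<tau>)\<close>, hence the
  normalizing sum lies between \<open>n\<close> and \<open>n * exp (1 / \<tau>)\<close> for
  \<open>n\<close> alternatives; bound numerator and denominator separately.\<close>

lemma softmax_bounds:
  fixes \<theta> :: "real ^ 'n"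
  assumes "0 < \<tau>" and \<theta>: "\<forall>i. 0 \<le> \<theta> $ i \<and> \<theta> $ i \<le> 1"
  shows "exp (- (1 / \<tau>)) / real CARD('n) \<le> softmax \<tau> \<theta> $ j"
    and "softmax \<tau> \<theta> $ j \<le> exp (1 / \<tau>) / real CARD('n)"
proof -
  let ?S = "\<Sum>l\<in>UNIV. exp (\<theta> $ l / \<tau>)"
  have e: "1 \<le> exp (\<theta> $ i / \<tau>)" "exp (\<theta> $ i / \<tau>) \<le> exp (1 / \<tau>)" for i
    using \<theta> \<open>0 < \<tau>\<close> by (auto intro: divide_right_mono)
  have S: "real CARD('n) \<le> ?S" "?S \<le> real CARD('n) * exp (1 / \<tau>)"
    using sum_mono[of UNIV "\<lambda>_. 1" "\<lambda>l. exp (\<theta> $ l / \<tau>)"] e sum_bounded_above[of UNIV "\<lambda>l. exp (\<theta> $ l / \<tau>)"]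
    by auto
  have "0 < real CARD('n)"
    by simp
  with S(1) have S_pos: "0 < ?S"
    by linarith
  have "exp (- (1 / \<tau>)) / real CARD('n) = 1 / (real CARD('n) * exp (1 / \<tau>))"
    by (simp add: exp_minus field_simps)
  also have "\<dots> \<le> exp (\<theta> $ j / \<tau>) / ?S"
    using e S S_pos by (intro frac_le) auto
  finally show "exp (- (1 / \<tau>)) / real CARD('n) \<le> softmax \<tau> \<theta> $ j"
    by (simp add: softmax_def)
  have "exp (\<theta> $ j / \<tau>) / ?S \<le> exp (1 / \<tau>) / real CARD('n)"
    using e S by (intro frac_le) auto
  then show "softmax \<tau> \<theta> $ j \<le> exp (1 / \<tau>) / real CARD('n)"
    by (simp add: softmax_def)
qed

lemma sum_softmax: "(\<Sum>j\<in>UNIV. softmax \<tau> \<theta> $ j) = 1"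
proof -
  have "0 < (\<Sum>l\<in>UNIV. exp (\<theta> $ l / \<tau>))"
    by (intro sum_pos) auto
  then show ?thesis
    by (simp add: softmax_def sum_divide_distrib[symmetric])
qed

lemma borel_measurable_softmax [measurable]: "(\<lambda>\<theta>. softmax \<tau> \<theta> $ j) \<in> borel_measurable borel"
  unfolding softmax_def by simp measurable

text \<open>Averaging preserves the coordinatewise softmax bounds. After taking logarithms they
  become a deviation of at most \<open>1 / \<tau>\<close> from \<open>- ln n\<close>, the
  log-probability under the uniform distribution.\<close>

lemma softmax_mixtureD:
  fixes q :: "real ^ 'n"
  assumes q: "softmax_mixture \<tau> q" and "0 < \<tau>"
  shows "q \<in> open_simplex" and "\<bar>ln (q $ j) + ln (real CARD('n))\<bar> \<le> 1 / \<tau>"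
proof -
  from q obtain M where M: "prob_space M" "sets M = sets borel"
    "AE \<theta> in M. \<forall>i. 0 \<le> \<theta> $ i \<and> \<theta> $ i \<le> 1"
    and q_eq: "q = (\<chi> j. integral\<^sup>L M (\<lambda>\<theta>. softmax \<tau> \<theta> $ j))"
    unfolding softmax_mixture_def by blast
  interpret prob_space M by fact
  have bounds: "AE \<theta> in M. exp (- (1 / \<tau>)) / real CARD('n) \<le> softmax \<tau> \<theta> $ j"
    "AE \<theta> in M. softmax \<tau> \<theta> $ j \<le> exp (1 / \<tau>) / real CARD('n)" for j
    using M(3) by (auto elim!: eventually_mono intro: softmax_bounds[OF \<open>0 < \<tau>\<close>])
  \<comment> \<open>Softmax coordinates are nonnegative, so the upper bound also bounds the norm;
    bounded measurable functions on a probability space are integrable.\<close>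
  have "AE \<theta> in M. norm (softmax \<tau> \<theta> $ j) \<le> exp (1 / \<tau>) / real CARD('n)" for j
    using bounds(2)[of j] by eventually_elim (simp add: softmax_def sum_nonneg)
  moreover have "(\<lambda>\<theta>. softmax \<tau> \<theta> $ j) \<in> borel_measurable M" for j
    using borel_measurable_softmax measurable_cong_sets[OF M(2) refl] by blast
  ultimately have int: "integrable M (\<lambda>\<theta>. softmax \<tau> \<theta> $ j)" for j
    by (intro integrable_const_bound)
  have ge: "exp (- (1 / \<tau>)) / real CARD('n) \<le> q $ j"
    and le: "q $ j \<le> exp (1 / \<tau>) / real CARD('n)" for j
    using integral_ge_const[OF int bounds(1)] integral_le_const[OF int bounds(2)] by (simp_all add: q_eq)
  have n_pos: "0 < real CARD('n)"
    by simp
  have q_pos: "0 < q $ j" for j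
    by (rule less_le_trans[OF _ ge]) simp
  have "(\<Sum>j\<in>UNIV. q $ j) = integral\<^sup>L M (\<lambda>\<theta>. \<Sum>j\<in>UNIV. softmax \<tau> \<theta> $ j)"
    by (simp add: q_eq int)
  also have "\<dots> = 1"
    by (simp add: sum_softmax prob_space)
  finally show "q \<in> open_simplex"
    using q_pos by (simp add: open_simplex_eq)
  have "ln (exp (- (1 / \<tau>)) / real CARD('n)) \<le> ln (q $ j)"
    "ln (q $ j) \<le> ln (exp (1 / \<tau>) / real CARD('n))"
    using ge[of j] le[of j] q_pos[of j] by (subst ln_le_cancel_iff; simp)+
  then show "\<bar>ln (q $ j) + ln (real CARD('n))\<bar> \<le> 1 / \<tau>"
    by (simp add: ln_div)
qed

text \<open>The three counts are at most \<open>card A\<close>, \<open>card E'\<close> and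
  \<open>K - card A - card E'\<close>. The last assumption makes this truncated subtraction exact,
  so they add up to at most \<open>K\<close>.\<close>

lemma final_share_bounds:
  fixes X :: "'e \<Rightarrow> 'n::finite \<Rightarrow> bool"
  assumes "finite A" "finite E'" "0 < K" "card A + card E' \<le> K"
  shows "0 \<le> final_share K X A E' xs $ i" "final_share K X A E' xs $ i \<le> 1"
proof -
  have "card {e \<in> A. X e i} \<le> card A" "card {e \<in> E'. X e i} \<le> card E'"
    using assms by (auto intro: card_mono)
  moreover have "length (filter (\<lambda>v. v i) (take (K - card A - card E') xs)) \<le> K - card A - card E'"
    by (rule order_trans[OF length_filter_le]) simp
  ultimately have "card {e \<in> A. X e i} + card {e \<in> E'. X e i} +
      length (filter (\<lambda>v. v i) (take (K - card A - card E') xs)) \<le> K"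
    using assms(4) by linarith
  then show "final_share K X A E' xs $ i \<le> 1"
    \<comment> \<open>Keeping the sum inside \<open>real\<close> reduces the claim to the inequality
      of natural numbers just shown.\<close>
    using \<open>0 < K\<close> unfolding final_share_def by (simp del: of_nat_add)
qed (simp add: final_share_def)

text \<open>The mixing measure is the push-forward of \<open>fut\<close> under the final share. Thus
  the trader's belief is of the same kind as the predecessor's report, and the same bounds apply to
  both.\<close>

lemma softmax_mixture_endo_belief:
  fixes X :: "'e \<Rightarrow> 'n::finite \<Rightarrow> bool"
  assumes "finite A" "finite E'" "0 < K" "card A + card E' \<le> K"
  shows "softmax_mixture \<tau> (endo_belief \<tau> K X A fut E')"
proof -
  let ?M = "distr (measure_pmf fut) borel (final_share K X A E')"
  have "prob_space ?M"
    by (intro measure_pmf.prob_space_distr) simp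
  moreover have "AE \<theta> in ?M. \<forall>i. 0 \<le> \<theta> $ i \<and> \<theta> $ i \<le> 1"
    by (subst AE_distr_iff) (auto simp: final_share_bounds[OF assms])
  moreover have "endo_belief \<tau> K X A fut E' = (\<chi> j. integral\<^sup>L ?M (\<lambda>\<theta>. softmax \<tau> \<theta> $ j))"
    by (simp add: endo_belief_def integral_distr borel_measurable_softmax)
  ultimately show ?thesis
    unfolding softmax_mixture_def by (intro exI[of _ ?M]) simp
qed

section \<open>Gain from withholding evidence under endogenous resolution\<close>

text \<open>As \<open>b\<close> sums to 1, the cross entropy sum plus \<open>c\<close> is the
  \<open>b\<close>-average of the numbers \<open>ln (p $ j) + c\<close>. It is used with
  \<open>c = ln n\<close> and \<open>d = 1 / \<tau>\<close>.\<close>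

lemma cross_entropy_bounds:
  fixes b p :: "real ^ 'n"
  assumes b: "b \<in> open_simplex" and p: "\<And>j. \<bar>ln (p $ j) + c\<bar> \<le> d"
  shows "\<bar>(\<Sum>\<omega>\<in>UNIV. b $ \<omega> * ln (p $ \<omega>)) + c\<bar> \<le> d"
proof -
  have pos: "0 \<le> b $ \<omega>" for \<omega>
    using b by (auto simp: open_simplex_eq less_imp_le)
  have sum: "(\<Sum>\<omega>\<in>UNIV. b $ \<omega>) = 1"
    using b by (simp add: open_simplex_eq)
  have "(\<Sum>\<omega>\<in>UNIV. b $ \<omega> * ln (p $ \<omega>)) + c = (\<Sum>\<omega>\<in>UNIV. b $ \<omega> * (ln (p $ \<omega>) + c))"
    by (simp add: distrib_left sum.distrib sum_distrib_right[symmetric] sum)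
  also have "\<bar>\<dots>\<bar> \<le> (\<Sum>\<omega>\<in>UNIV. b $ \<omega> * d)"
    using p pos by (intro order_trans[OF sum_abs] sum_mono) (simp add: abs_mult mult_left_mono)
  also have "\<dots> = d"
    by (simp add: sum_distrib_right[symmetric] sum)
  finally show ?thesis .
qed

text \<open>All logarithmic averages in the two payoffs are within \<open>1 / \<tau>\<close> of
  \<open>- ln n\<close>. The deviations of the two terms for the trader's own report contribute at
  most \<open>\<beta> (r A) / \<tau>\<close> each, and the difference of the two predecessor terms
  at most twice that. What remains is a loss from withholding.\<close>

lemma endogenous_gain_le:
  fixes X :: "'e \<Rightarrow> 'n::finite \<Rightarrow> bool" and q0 :: "real ^ 'n"
  assumes fin: "finite A" "finite E" and K: "0 < K" "card A + card E \<le> K"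
    and E': "E' \<subseteq> E" and \<tau>: "0 < \<tau>" and q0: "softmax_mixture \<tau> q0"
    and \<beta>: "0 \<le> \<beta> (r (A \<union> E))" "\<beta> (r (A \<union> E)) \<le> \<beta> (r (A \<union> E'))" "\<beta> (r (A \<union> E')) \<le> \<beta> (r A)"
  shows "expected_payoff \<beta> r A q0 (endo_belief \<tau> K X A fut E') (endo_belief \<tau> K X A fut E') E'
     - expected_payoff \<beta> r A q0 (endo_belief \<tau> K X A fut E) (endo_belief \<tau> K X A fut E) E
     \<le> 4 * \<beta> (r A) / \<tau>"
proof -
  define b' where "b' = endo_belief \<tau> K X A fut E'"
  define b where "b = endo_belief \<tau> K X A fut E"
  define L where "L = ln (real CARD('n))"
  have L: "0 \<le> L"
    by (simp add: L_def Suc_leI)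
  have E'_props: "finite E'" "card A + card E' \<le> K"
    using E' fin K card_mono[OF fin(2) E'] finite_subset by auto
  have b': "softmax_mixture \<tau> b'" and b: "softmax_mixture \<tau> b"
    unfolding b'_def b_def using softmax_mixture_endo_belief fin K E'_props by blast+
  define d where "d = 1 / \<tau>"
  have d: "0 \<le> d"
    using \<tau> by (simp add: d_def)
  have near_uniform: "\<bar>(\<Sum>\<omega>\<in>UNIV. p $ \<omega> * ln (q $ \<omega>)) + L\<bar> \<le> d"
    if "softmax_mixture \<tau> p" "softmax_mixture \<tau> q" for p q :: "real ^ 'n"
    unfolding L_def d_def using that \<tau> by (intro cross_entropy_bounds softmax_mixtureD)
  define a where "a = (\<Sum>\<omega>\<in>UNIV. b' $ \<omega> * ln (b' $ \<omega>))"
  define c where "c = (\<Sum>\<omega>\<in>UNIV. b $ \<omega> * ln (b $ \<omega>))"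
  define u where "u = (\<Sum>\<omega>\<in>UNIV. b' $ \<omega> * ln (q0 $ \<omega>))"
  define v where "v = (\<Sum>\<omega>\<in>UNIV. b $ \<omega> * ln (q0 $ \<omega>))"
  have "\<bar>a + L\<bar> \<le> d" "\<bar>c + L\<bar> \<le> d" "\<bar>u + L\<bar> \<le> d" "\<bar>v + L\<bar> \<le> d"
    unfolding a_def c_def u_def v_def using b b' q0 by (blast intro: near_uniform)+
  then have "a + L \<le> d" "- (c + L) \<le> d" "v - u \<le> 2 * d"
    by (auto simp: abs_le_iff)
  then have "\<beta> (r (A \<union> E')) * (a + L) \<le> \<beta> (r (A \<union> E')) * d"
    "\<beta> (r (A \<union> E)) * - (c + L) \<le> \<beta> (r (A \<union> E)) * d"
    "\<beta> (r A) * (v - u) \<le> \<beta> (r A) * (2 * d)"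
    using \<beta> by (intro mult_left_mono; simp)+
  moreover have "\<beta> (r (A \<union> E')) * d \<le> \<beta> (r A) * d"
    "\<beta> (r (A \<union> E)) * d \<le> \<beta> (r A) * d"
    using \<beta> d by (intro mult_right_mono; simp)+
  \<comment> \<open>At exactly uniform beliefs, withholding would cost this amount, since
    \<open>L\<close> is the entropy of the uniform distribution; only its sign enters the
    bound.\<close>
  moreover have "0 \<le> (\<beta> (r (A \<union> E')) - \<beta> (r (A \<union> E))) * L"
    using \<beta> L by simp
  ultimately have "\<beta> (r (A \<union> E')) * a - \<beta> (r A) * u - (\<beta> (r (A \<union> E)) * c - \<beta> (r A) * v)
      \<le> 4 * \<beta> (r A) * d"
    by (simp add: algebra_simps)
  then show ?thesis
    by (simp add: expected_payoff_eq a_def c_def u_def v_def b'_def b_def d_def)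
qed

section \<open>Payoff decomposition and incentives to submit evidence\<close>

text \<open>Optimality in (a) is graded. Withholding can be free if \<open>\<beta>\<close> is
  constant somewhere or the entropy is 0, so a weakly decreasing \<open>\<beta>\<close> gives weak
  optimality. Under strict decrease and two alternatives, \<open>E\<close> is singled out up to
  equal quality, and uniquely if proper subsets have smaller quality. In (b), \<open>\<tau>\<close>
  precedes \<open>q0\<close> and \<open>fut\<close>: one temperature serves all predecessors and
  futures.\<close>

theorem theorem2:
  fixes \<beta> :: "real \<Rightarrow> real"
    and r :: "'e set \<Rightarrow> real"
    and A E :: "'e set"
  assumes beta_pos: "\<And>R. 0 \<le> R \<Longrightarrow> 0 < \<beta> R"
    and beta_decreasing: "antimono_on {0..} \<beta>"
    and r_nonneg: "\<And>F. finite F \<Longrightarrow> 0 \<le> r F"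
    and r_mono: "\<And>F G. finite G \<Longrightarrow> F \<subseteq> G \<Longrightarrow> r F \<le> r G"
    and fin_A: "finite A"
    and fin_E: "finite E"
  shows
    \<comment> \<open>payoff decomposition, for an arbitrary belief that may depend on the submission\<close>
    "(\<forall>(q0 :: real ^ 'n) \<in> open_simplex. \<forall>q :: 'e set \<Rightarrow> real ^ 'n.
        (\<forall>E' \<subseteq> E. q E' \<in> open_simplex) \<longrightarrow>
        (\<forall>E' \<subseteq> E. let x = \<beta> (r A) - \<beta> (r (A \<union> E')) in
           0 \<le> x \<and>
           expected_payoff \<beta> r A q0 (q E') (q E') E' =
             \<beta> (r A) * KL_div (q E') q0 + x * shannon_entropy (q E')))
     \<and>
     \<comment> \<open>(a) exogenous resolution\<close>
     (\<forall>(q0 :: real ^ 'n) \<in> open_simplex. \<forall>(q :: real ^ 'n) \<in> open_simplex.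
        (\<forall>E' \<subseteq> E. \<forall>p \<in> open_simplex.
           expected_payoff \<beta> r A q0 q p E' \<le> expected_payoff \<beta> r A q0 q q E) \<and>
        (2 \<le> CARD('n) \<and> strict_antimono_on {0..} \<beta> \<longrightarrow>
           (\<forall>E' \<subseteq> E. \<forall>p \<in> open_simplex.
              p \<noteq> q \<or> r (A \<union> E') \<noteq> r (A \<union> E) \<longrightarrow>
              expected_payoff \<beta> r A q0 q p E' < expected_payoff \<beta> r A q0 q q E) \<and>
           ((\<forall>E' \<subset> E. r (A \<union> E') < r (A \<union> E)) \<longrightarrow>
              (\<forall>E' \<subseteq> E. \<forall>p \<in> open_simplex.
                 (E', p) \<noteq> (E, q) \<longrightarrow>
                 expected_payoff \<beta> r A q0 q p E' < expected_payoff \<beta> r A q0 q q E))))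
     \<and>
     \<comment> \<open>(b) endogenous resolution\<close>
     (\<forall>(X :: 'e \<Rightarrow> 'n \<Rightarrow> bool) K. 0 < K \<and> card A + card E \<le> K \<longrightarrow>
        (\<forall>\<epsilon>>0. \<exists>\<tau>>0. \<forall>(q0 :: real ^ 'n) fut.
           softmax_mixture \<tau> q0 \<and> (\<forall>xs \<in> set_pmf fut. length xs = K - card A) \<longrightarrow>
           (\<forall>E' \<subseteq> E.
              expected_payoff \<beta> r A q0 (endo_belief \<tau> K X A fut E') (endo_belief \<tau> K X A fut E') E'
              - expected_payoff \<beta> r A q0 (endo_belief \<tau> K X A fut E) (endo_belief \<tau> K X A fut E) E
              \<le> \<epsilon>)))"
proof -
  have r0: "r (A \<union> E') \<ge> 0" if "E' \<subseteq> E" for E'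
    using that fin_A fin_E finite_subset by (intro r_nonneg) auto
  have r_le: "r (A \<union> F) \<le> r (A \<union> G)" if "F \<subseteq> G" "G \<subseteq> E" for F G
    using that fin_A fin_E by (intro r_mono) (auto intro: finite_subset)
  have \<beta>_le: "\<beta> (r (A \<union> G)) \<le> \<beta> (r (A \<union> F))" if "F \<subseteq> G" "G \<subseteq> E" for F G
    using monotone_onD[OF beta_decreasing] r_le[OF that] r0 that by auto
  have \<beta>_pos: "0 < \<beta> (r (A \<union> F))" if "F \<subseteq> E" for F
    using beta_pos r0 that by auto
  \<comment> \<open>Substituting \<open>\<beta> (r A) - x\<close> for
    \<open>\<beta> (r (A \<union> E'))\<close> separates the divergence from the entropy term;
    \<open>0 \<le> x\<close> is monotonicity from the empty submission to \<open>E'\<close>.\<close>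
  have decomposition: "let x = \<beta> (r A) - \<beta> (r (A \<union> E')) in 0 \<le> x \<and>
      expected_payoff \<beta> r A q0 q q E' = \<beta> (r A) * KL_div q q0 + x * shannon_entropy q"
    if "q0 \<in> open_simplex" "q \<in> open_simplex" "E' \<subseteq> E" for q0 q :: "real ^ 'n" and E'
    using that \<beta>_le[of "{}" E']
    by (simp add: Let_def expected_payoff_eq KL_div_eq_diff shannon_entropy_def algebra_simps)
  have report_truth: "expected_payoff \<beta> r A q0 q p E' \<le> expected_payoff \<beta> r A q0 q q E'"
    if "q \<in> open_simplex" "p \<in> open_simplex" "E' \<subseteq> E" for q0 q p :: "real ^ 'n" and E'
    using that Gibbs_inequality[of p q] \<beta>_pos[of E'] by (simp add: expected_payoff_eq)
  have report_truth_strict: "expected_payoff \<beta> r A q0 q p E' < expected_payoff \<beta> r A q0 q q E'"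
    if "q \<in> open_simplex" "p \<in> open_simplex" "E' \<subseteq> E" "p \<noteq> q" for q0 q p :: "real ^ 'n" and E'
    using that Gibbs_inequality_strict[of p q] \<beta>_pos[of E'] by (simp add: expected_payoff_eq)
  \<comment> \<open>For a fixed belief the predecessor's term cancels, so evidence only rescales the
    entropy cost of the truthful report.\<close>
  have evidence_gain: "expected_payoff \<beta> r A q0 q q E - expected_payoff \<beta> r A q0 q q E' =
      (\<beta> (r (A \<union> E')) - \<beta> (r (A \<union> E))) * shannon_entropy q" for q0 q :: "real ^ 'n" and E'
    by (simp add: expected_payoff_eq shannon_entropy_def algebra_simps)
  have submit_all: "expected_payoff \<beta> r A q0 q q E' \<le> expected_payoff \<beta> r A q0 q q E"
    if "q \<in> open_simplex" "E' \<subseteq> E" for q0 q :: "real ^ 'n" and E'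
  proof -
    have "0 \<le> (\<beta> (r (A \<union> E')) - \<beta> (r (A \<union> E))) * shannon_entropy q"
      using \<beta>_le[of E' E] shannon_entropy_nonneg[of q] that by simp
    then show ?thesis
      using evidence_gain[of q0 q E'] by simp
  qed
  have weak: "expected_payoff \<beta> r A q0 q p E' \<le> expected_payoff \<beta> r A q0 q q E"
    if "q \<in> open_simplex" "p \<in> open_simplex" "E' \<subseteq> E" for q0 q p :: "real ^ 'n" and E'
    using report_truth submit_all that by (meson order_trans)
  have strict: "expected_payoff \<beta> r A q0 q p E' < expected_payoff \<beta> r A q0 q q E"
    if card: "2 \<le> CARD('n)" and \<beta>_strict: "strict_antimono_on {0..} \<beta>"
      and q: "q \<in> open_simplex" and p: "p \<in> open_simplex" and E': "E' \<subseteq> E"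
      and ne: "p \<noteq> q \<or> r (A \<union> E') \<noteq> r (A \<union> E)" for q0 q p :: "real ^ 'n" and E'
  \<comment> \<open>A false report loses strictly by Gibbs' inequality and evidence helps weakly;
    for a truthful report the strictness must come from the evidence.\<close>
  proof (cases "p = q")
    case False
    then show ?thesis
      using report_truth_strict submit_all q p E' by (meson less_le_trans)
  next
    case True
    with ne r_le[OF E'] have "r (A \<union> E') < r (A \<union> E)"
      by fastforce
    then have "\<beta> (r (A \<union> E)) < \<beta> (r (A \<union> E'))"
      using monotone_onD[OF \<beta>_strict] r0 E' by auto
    then have "0 < (\<beta> (r (A \<union> E')) - \<beta> (r (A \<union> E))) * shannon_entropy q"
      using shannon_entropy_pos[OF q card] by simp
    then show ?thesis
      using evidence_gain[of q0 q E'] True by simp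
  qed
  have endogenous: "\<exists>\<tau>>0. \<forall>(q0 :: real ^ 'n) fut.
      softmax_mixture \<tau> q0 \<and> (\<forall>xs \<in> set_pmf fut. length xs = K - card A) \<longrightarrow>
      (\<forall>E' \<subseteq> E.
         expected_payoff \<beta> r A q0 (endo_belief \<tau> K X A fut E') (endo_belief \<tau> K X A fut E') E'
         - expected_payoff \<beta> r A q0 (endo_belief \<tau> K X A fut E) (endo_belief \<tau> K X A fut E) E \<le> \<epsilon>)"
    if K: "0 < K" "card A + card E \<le> K" and "0 < \<epsilon>" for X :: "'e \<Rightarrow> 'n \<Rightarrow> bool" and K \<epsilon>
  proof -
    \<comment> \<open>This solves \<open>4 * \<beta> (r A) / \<tau> = \<epsilon>\<close>, where the
      left side is the bound on the gain; it involves neither \<open>q0\<close> nor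
      \<open>fut\<close> nor \<open>E'\<close>.\<close>
    define \<tau> where "\<tau> = 4 * \<beta> (r A) / \<epsilon>"
    have "0 < \<beta> (r A)"
      using \<beta>_pos[of "{}"] by simp
    with \<open>0 < \<epsilon>\<close> have \<tau>: "0 < \<tau>" "4 * \<beta> (r A) / \<tau> = \<epsilon>"
      by (simp_all add: \<tau>_def)
    show ?thesis
    proof (intro exI[of _ \<tau>] conjI allI impI \<tau>(1))
      fix q0 :: "real ^ 'n" and fut :: "('n \<Rightarrow> bool) list pmf" and E'
      assume "softmax_mixture \<tau> q0 \<and> (\<forall>xs \<in> set_pmf fut. length xs = K - card A)" "E' \<subseteq> E"
      then show "expected_payoff \<beta> r A q0 (endo_belief \<tau> K X A fut E') (endo_belief \<tau> K X A fut E') E'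
          - expected_payoff \<beta> r A q0 (endo_belief \<tau> K X A fut E) (endo_belief \<tau> K X A fut E) E \<le> \<epsilon>"
        using \<beta>_pos[of E] \<beta>_le[of E' E] \<beta>_le[of "{}" E']
        unfolding \<tau>(2)[symmetric]
        by (intro endogenous_gain_le[OF fin_A fin_E K _ \<tau>(1)]) auto
    qed
  qed
  show ?thesis
  proof (intro conjI)
    show "\<forall>(q0 :: real ^ 'n) \<in> open_simplex. \<forall>q :: 'e set \<Rightarrow> real ^ 'n.
        (\<forall>E' \<subseteq> E. q E' \<in> open_simplex) \<longrightarrow>
        (\<forall>E' \<subseteq> E. let x = \<beta> (r A) - \<beta> (r (A \<union> E')) in
           0 \<le> x \<and>
           expected_payoff \<beta> r A q0 (q E') (q E') E' =
             \<beta> (r A) * KL_div (q E') q0 + x * shannon_entropy (q E'))"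
      using decomposition by blast
  next
    show "\<forall>(q0 :: real ^ 'n) \<in> open_simplex. \<forall>(q :: real ^ 'n) \<in> open_simplex.
        (\<forall>E' \<subseteq> E. \<forall>p \<in> open_simplex.
           expected_payoff \<beta> r A q0 q p E' \<le> expected_payoff \<beta> r A q0 q q E) \<and>
        (2 \<le> CARD('n) \<and> strict_antimono_on {0..} \<beta> \<longrightarrow>
           (\<forall>E' \<subseteq> E. \<forall>p \<in> open_simplex.
              p \<noteq> q \<or> r (A \<union> E') \<noteq> r (A \<union> E) \<longrightarrow>
              expected_payoff \<beta> r A q0 q p E' < expected_payoff \<beta> r A q0 q q E) \<and>
           ((\<forall>E' \<subset> E. r (A \<union> E') < r (A \<union> E)) \<longrightarrow>
              (\<forall>E' \<subseteq> E. \<forall>p \<in> open_simplex.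
                 (E', p) \<noteq> (E, q) \<longrightarrow>
                 expected_payoff \<beta> r A q0 q p E' < expected_payoff \<beta> r A q0 q q E)))"
    proof (intro ballI conjI impI allI)
      fix q0 q p :: "real ^ 'n" and E'
      assume *: "q \<in> open_simplex" "p \<in> open_simplex" "E' \<subseteq> E" "(E', p) \<noteq> (E, q)"
        and "2 \<le> CARD('n) \<and> strict_antimono_on {0..} \<beta>" "\<forall>E' \<subset> E. r (A \<union> E') < r (A \<union> E)"
      \<comment> \<open>If \<open>p = q\<close>, then \<open>E'\<close> is a proper subset of
        \<open>E\<close> and hence has strictly smaller quality.\<close>
      moreover from this have "p \<noteq> q \<or> r (A \<union> E') \<noteq> r (A \<union> E)"
        by (metis order.not_eq_order_implies_strict order_less_irrefl)
      ultimately show "expected_payoff \<beta> r A q0 q p E' < expected_payoff \<beta> r A q0 q q E"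
        by (intro strict) auto
    qed (use weak strict in auto)
  next
    show "\<forall>(X :: 'e \<Rightarrow> 'n \<Rightarrow> bool) K. 0 < K \<and> card A + card E \<le> K \<longrightarrow>
        (\<forall>\<epsilon>>0. \<exists>\<tau>>0. \<forall>(q0 :: real ^ 'n) fut.
           softmax_mixture \<tau> q0 \<and> (\<forall>xs \<in> set_pmf fut. length xs = K - card A) \<longrightarrow>
           (\<forall>E' \<subseteq> E.
              expected_payoff \<beta> r A q0 (endo_belief \<tau> K X A fut E') (endo_belief \<tau> K X A fut E') E'
              - expected_payoff \<beta> r A q0 (endo_belief \<tau> K X A fut E) (endo_belief \<tau> K X A fut E) E
              \<le> \<epsilon>))"
      by (intro allI impI endogenous) auto
  qed
qed

end
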